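(* Let $K=4$, $d=2$, let the feature vectors be $x_1=(0,-2)^\top$, $x_2=(-1,0)^\top$, $x_3=(0,1)^\top$, $x_4=(2,0)^\top$ (the rows of $X\in\mathbb{R}^{4\times 2}$), and let $r=(9,8,7,6)^\top$. There exists a constant learning rate $\eta>0$ such that for every initialization $\theta_1\in\mathbb{R}^2$, the iterates $$\theta_{t+1}=\theta_t+\eta\,X^\top\big(\mathrm{diag}(\pi_{\theta_t})-\pi_{\theta_t}\pi_{\theta_t}^\top\big)r,\qquad t\ge 1,$$ satisfy $\lim_{t\to\infty}\pi_{\theta_t}(1)=1$ (action $1$ is the action with the largest reward).
   Context: For $\theta\in\mathbb{R}^d$, $\pi_\theta=\mathrm{softmax}(X\theta)$ is the probability vector on $[K]=\{1,\dots,K\}$ with $\pi_\theta(a)=\exp(\langle x_a,\theta\rangle)/\sum_{a'\in[K]}\exp(\langle x_{a'},\theta\rangle)$, where $x_a\in\mathbb{R}^d$ is the $a$-th row of $X$. $\mathrm{diag}(\pi)$ is the diagonal matrix with diagonal $\pi$. *)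

theory Defs
  imports "HOL-Analysis.Analysis"
begin

definition softmax :: "real ^ 'k \<Rightarrow> real ^ 'k" where
  "softmax z = (\<chi> a. exp (z $ a) / (\<Sum>b\<in>UNIV. exp (z $ b)))"

definition diag :: "real ^ 'k \<Rightarrow> real ^ 'k ^ 'k" where
  "diag v = (\<chi> i j. if i = j then v $ i else 0)"

definition outer_prod :: "real ^ 'm \<Rightarrow> real ^ 'n \<Rightarrow> real ^ 'n ^ 'm" where
  "outer_prod u v = (\<chi> i j. u $ i * v $ j)"

(* X $ a is the feature vector of action a. *)
definition policy :: "real ^ 'd ^ 'k \<Rightarrow> real ^ 'd \<Rightarrow> real ^ 'k" where
  "policy X \<theta> = softmax (X *v \<theta>)"

lemma policy_nth:
  "policy X \<theta> $ a = exp (X $ a \<bullet> \<theta>) / (\<Sum>b\<in>UNIV. exp (X $ b \<bullet> \<theta>))"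
  by (simp add: policy_def softmax_def matrix_vector_mul_component)

(* In the index type 4 the numeral 4 denotes 0; the indices 1, 2, 3, 4 are nevertheless
   pairwise distinct and exhaust the type, and "vector" fills them in this order. *)
lemma vector_4:
  "(vector [w, x, y, z] :: 'a::zero ^ 4) $ 1 = w"
  "(vector [w, x, y, z] :: 'a::zero ^ 4) $ 2 = x"
  "(vector [w, x, y, z] :: 'a::zero ^ 4) $ 3 = y"
  "(vector [w, x, y, z] :: 'a::zero ^ 4) $ 4 = z"
  unfolding vector_def by simp_all

end

theory Submission
  imports Defs
begin

text \<open>
  The update is gradient ascent on the mean reward \<open>m = \<langle>\<pi>, r\<rangle>\<close>, which for a small learning rate
  increases by at least a constant multiple of the squared gradient, so \<open>m\<close> converges to a limit
  \<open>L\<close> and the gradient tends to 0. The gradient vanishes at no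
  \<open>\<theta>\<close>, so \<open>m\<close> is strictly increasing, and a gradient tending to 0 leaves only \<open>L = 7\<close> (all mass on
  action 3), \<open>L = 8\<close> (all mass on action 2) and \<open>L = 9\<close>. With \<open>\<theta> = (u, v)\<close>: if \<open>L = 7\<close>, then
  \<open>m < 7\<close> forces \<open>u > 0\<close>, while eventually \<open>u + v\<close> does not increase, so \<open>v\<close> cannot tend to
  infinity. If \<open>L = 8\<close>, then \<open>m < 8\<close> forces \<open>v \<ge> 0\<close> eventually, while \<open>u - 14 v\<close> eventually does
  not decrease, so \<open>u\<close> cannot tend to minus infinity.
\<close>

section \<open>Estimates for the exponential and for real sequences\<close>

lemma exp_le_quadratic:
  fixes x :: real
  assumes "\<bar>x\<bar> \<le> 1"
  shows "exp x \<le> 1 + x + x\<^sup>2"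
proof (cases "x \<ge> 0")
  case True
  then show ?thesis using assms exp_bound by auto
next
  case False
  have "1 - x \<le> exp (- x)" using exp_ge_add_one_self[of "- x"] by simp
  then have "exp x \<le> 1 / (1 - x)"
    using False by (simp add: exp_minus field_simps)
  also have "\<dots> \<le> 1 + x + x\<^sup>2"
  proof -
    have "(1 + x + x\<^sup>2) * (1 - x) = 1 - x ^ 3"
      by (simp add: algebra_simps power2_eq_square power3_eq_cube)
    moreover have "x ^ 3 \<le> 0" using False by (simp add: power_le_zero_eq)
    ultimately show ?thesis using False by (simp add: divide_le_eq)
  qed
  finally show ?thesis .
qed

text \<open>The remainder \<open>exp x - 1 - x\<close> lies between 0 and \<open>x\<^sup>2\<close>,
  so the bound holds for \<open>c\<close> of either sign. Below, \<open>c\<close> is the advantage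
  of an action over the mean reward, whose sign varies.\<close>

lemma mult_exp_ge_quadratic:
  fixes c x D :: real
  assumes "\<bar>x\<bar> \<le> 1" "\<bar>c\<bar> \<le> D"
  shows "c * exp x \<ge> c + c * x - D * x\<^sup>2"
proof -
  have q: "0 \<le> exp x - 1 - x" "exp x - 1 - x \<le> x\<^sup>2"
    using exp_ge_add_one_self[of x] exp_le_quadratic[OF assms(1)] by linarith+
  have "\<bar>c * (exp x - 1 - x)\<bar> \<le> D * x\<^sup>2"
    unfolding abs_mult using q assms(2) by (intro mult_mono) auto
  then show ?thesis by (simp add: algebra_simps abs_le_iff)
qed

text \<open>Serves mainly to turn a vanishing gradient component into a vanishing action
  probability, by squeezing \<open>x n\<close> below \<open>f n / c\<close>.\<close>

lemma tendsto_zero_of_mult_le: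
  fixes x f :: "nat \<Rightarrow> real"
  assumes "\<And>n. 0 \<le> x n" "0 < c" "f \<longlonglongrightarrow> 0" "\<forall>\<^sub>F n in sequentially. x n * c \<le> f n"
  shows "x \<longlonglongrightarrow> 0"
proof (rule real_tendsto_sandwich[OF _ _ tendsto_const])
  show "\<forall>\<^sub>F n in sequentially. 0 \<le> x n" using assms(1) by simp
  show "\<forall>\<^sub>F n in sequentially. x n \<le> f n / c"
    using assms(4) by eventually_elim (use assms(2) in \<open>simp add: pos_le_divide_eq\<close>)
  show "(\<lambda>n. f n / c) \<longlonglongrightarrow> 0" using tendsto_divide_zero[OF assms(3)] .
qed

lemma le_of_Suc_le:
  fixes f :: "nat \<Rightarrow> 'a::preorder"
  assumes "\<And>t. t \<ge> N \<Longrightarrow> f t \<le> f (Suc t)" "N \<le> t"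
  shows "f N \<le> f t"
  using assms(2)
proof (induction t rule: dec_induct)
  case (step n)
  then show ?case using assms(1)[of n] order_trans by blast
qed simp

section \<open>The iteration in scalar coordinates\<close>

text \<open>Here \<open>(u, v)\<close> is the parameter vector, \<open>m\<close> the mean reward and
  1/100 the learning rate. The gradient \<open>(gu, gv)\<close> sums, over the actions, feature
  times probability times (reward minus \<open>m\<close>).\<close>

locale policy_gradient =
  fixes u v p1 p2 p3 p4 m gu gv Z :: "nat \<Rightarrow> real"
  assumes Z: "Z t = exp (- 2 * v t) + exp (- u t) + exp (v t) + exp (2 * u t)"
    and p1: "p1 t = exp (- 2 * v t) / Z t"
    and p2: "p2 t = exp (- u t) / Z t"
    and p3: "p3 t = exp (v t) / Z t"
    and p4: "p4 t = exp (2 * u t) / Z t"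
    and m: "m t = 9 * p1 t + 8 * p2 t + 7 * p3 t + 6 * p4 t"
    and gu: "gu t = 2 * p4 t * (6 - m t) - p2 t * (8 - m t)"
    and gv: "gv t = p3 t * (7 - m t) - 2 * p1 t * (9 - m t)"
    and u_Suc: "u (Suc t) = u t + gu t / 100"
    and v_Suc: "v (Suc t) = v t + gv t / 100"
begin

lemma Z_pos: "Z t > 0"
  unfolding Z by (intro add_pos_pos) auto

lemma p_pos: "p1 t > 0" "p2 t > 0" "p3 t > 0" "p4 t > 0"
  using Z_pos[of t] by (simp_all add: p1 p2 p3 p4)

lemma p_sum: "p1 t + p2 t + p3 t + p4 t = 1"
proof -
  have "p1 t + p2 t + p3 t + p4 t = Z t / Z t"
    unfolding p1 p2 p3 p4 by (simp only: add_divide_distrib[symmetric] Z[of t, symmetric])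
  then show ?thesis using Z_pos[of t] by simp
qed

lemma m_bounds: "6 < m t" "m t < 9"
  using p_pos[of t] p_sum[of t] unfolding m by linarith+

text \<open>Subtracting a multiple of the total mass 1 from \<open>m\<close> shows which actions
  keep \<open>m\<close> away from a given reward.\<close>

lemma m_deviation:
  "9 - m t = p2 t + 2 * p3 t + 3 * p4 t"
  "m t - 8 = p1 t - p3 t - 2 * p4 t"
  "m t - 7 = 2 * p1 t + p2 t - p4 t"
  using p_sum[of t] unfolding m by linarith+

text \<open>Neither summand of \<open>gu\<close> can be positive in this range, and the one of
  action 4 is strictly negative. Together with the range in \<open>gv_neg\<close> every value of
  \<open>m\<close> is covered, so the gradient has no zero.\<close>

lemma gu_neg: "gu t < 0" if "m t \<le> 8"
proof -
  have "0 < p4 t * (m t - 6)" "0 \<le> p2 t * (8 - m t)"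
    using that p_pos[of t] m_bounds[of t] by auto
  then show ?thesis unfolding gu by (simp add: algebra_simps)
qed

lemma gv_neg: "gv t < 0" if "m t \<ge> 7"
proof -
  have "0 < p1 t * (9 - m t)" "0 \<le> p3 t * (m t - 7)"
    using that p_pos[of t] m_bounds[of t] by auto
  then show ?thesis unfolding gv by (simp add: algebra_simps)
qed

text \<open>A crude bound that suffices to keep every change of a logit in one step, at rate 1/100,
  at most 1/5 in absolute value.\<close>

lemma g_bounds: "\<bar>gu t\<bar> \<le> 10" "\<bar>gv t\<bar> \<le> 10"
proof -
  have b: "\<bar>p * x\<bar> \<le> 3" if "0 < p" "p < 1" "\<bar>x\<bar> \<le> 3" for p x :: real
    using mult_mono[of p 1 "\<bar>x\<bar>" 3] that by (simp add: abs_mult)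
  have "p1 t < 1" "p2 t < 1" "p3 t < 1" "p4 t < 1"
    using p_pos[of t] p_sum[of t] by linarith+
  then have "\<bar>p4 t * (6 - m t)\<bar> \<le> 3" "\<bar>p2 t * (8 - m t)\<bar> \<le> 3"
      "\<bar>p3 t * (7 - m t)\<bar> \<le> 3" "\<bar>p1 t * (9 - m t)\<bar> \<le> 3"
    using p_pos[of t] m_bounds[of t] by (intro b; simp)+
  then show "\<bar>gu t\<bar> \<le> 10" "\<bar>gv t\<bar> \<le> 10"
    unfolding gu gv mult.assoc by linarith+
qed

section \<open>Ascent and convergence of the mean reward\<close>

text \<open>One step multiplies the weight of each action by the exponential of its logit change, so
  the increase is exactly \<open>N / W\<close>. Expanding \<open>N\<close> to second order, the
  constant term vanishes, the linear term is \<open>G / 100\<close> and the error is at most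
  \<open>3 * G / 2500\<close>.\<close>

lemma m_increase: "m (Suc t) - m t \<ge> ((gu t)\<^sup>2 + (gv t)\<^sup>2) / 600"
proof -
  \<comment> \<open>These are the changes of the four logits; \<open>W\<close> below is the ratio of
    the new normalizer to the old one.\<close>
  define y1 y2 y3 y4 where y: "y1 = - 2 * gv t / 100" "y2 = - gu t / 100"
    "y3 = gv t / 100" "y4 = 2 * gu t / 100"
  define G where "G = (gu t)\<^sup>2 + (gv t)\<^sup>2"
  define W where "W = p1 t * exp y1 + p2 t * exp y2 + p3 t * exp y3 + p4 t * exp y4"
  define N where "N = p1 t * ((9 - m t) * exp y1) + p2 t * ((8 - m t) * exp y2)
    + p3 t * ((7 - m t) * exp y3) + p4 t * ((6 - m t) * exp y4)"
  have y_abs: "\<bar>y1\<bar> \<le> 1" "\<bar>y2\<bar> \<le> 1" "\<bar>y3\<bar> \<le> 1" "\<bar>y4\<bar> \<le> 1"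
    using g_bounds[of t] unfolding y by auto
  have y_sq: "y1\<^sup>2 \<le> G / 2500" "y2\<^sup>2 \<le> G / 2500" "y3\<^sup>2 \<le> G / 2500" "y4\<^sup>2 \<le> G / 2500"
    unfolding y G_def by (simp_all add: power2_eq_square algebra_simps)
  have W_pos: "W > 0"
    unfolding W_def using p_pos[of t] by (intro add_pos_pos mult_pos_pos) auto
  have W_le: "W \<le> 3"
  proof -
    have "p * exp y \<le> p * 3" if "p > 0" "\<bar>y\<bar> \<le> 1" for p y :: real
      using that exp_le exp_le_cancel_iff[of y 1] by (intro mult_left_mono) linarith+
    then have "W \<le> p1 t * 3 + p2 t * 3 + p3 t * 3 + p4 t * 3"
      unfolding W_def using y_abs p_pos[of t] by (intro add_mono) auto
    then show ?thesis using p_sum[of t] by linarith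
  qed
  \<comment> \<open>The factor 3 bounds the advantage \<open>a - m t\<close>, since all rewards and
    \<open>m t\<close> lie between 6 and 9.\<close>
  have "p * ((a - m t) * exp y) \<ge> p * (a - m t) + p * (a - m t) * y - p * (3 * G / 2500)"
    if "p > 0" "\<bar>y\<bar> \<le> 1" "y\<^sup>2 \<le> G / 2500" "6 \<le> a" "a \<le> 9" for p a y :: real
  proof -
    have "\<bar>a - m t\<bar> \<le> 3" using m_bounds[of t] that by auto
    from mult_exp_ge_quadratic[OF that(2) this] that(3)
    have "(a - m t) * exp y \<ge> (a - m t) + (a - m t) * y - 3 * G / 2500" by linarith
    from mult_left_mono[OF this, of p] that(1) show ?thesis by (simp add: algebra_simps)
  qed
  from this[OF p_pos(1)[of t] y_abs(1) y_sq(1), of 9] this[OF p_pos(2)[of t] y_abs(2) y_sq(2), of 8]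
    this[OF p_pos(3)[of t] y_abs(3) y_sq(3), of 7] this[OF p_pos(4)[of t] y_abs(4) y_sq(4), of 6]
  have "N \<ge> (p1 t * (9 - m t) + p2 t * (8 - m t) + p3 t * (7 - m t) + p4 t * (6 - m t))
    + (p1 t * (9 - m t) * y1 + p2 t * (8 - m t) * y2 + p3 t * (7 - m t) * y3 + p4 t * (6 - m t) * y4)
    - (p1 t * (3 * G / 2500) + p2 t * (3 * G / 2500) + p3 t * (3 * G / 2500) + p4 t * (3 * G / 2500))"
    unfolding N_def by linarith
  moreover have "p1 t * (9 - m t) + p2 t * (8 - m t) + p3 t * (7 - m t) + p4 t * (6 - m t)
    = 0"
  proof -
    have "p1 t * (9 - m t) + p2 t * (8 - m t) + p3 t * (7 - m t) + p4 t * (6 - m t)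
      = m t - (p1 t + p2 t + p3 t + p4 t) * m t"
      by (simp add: m[of t] algebra_simps)
    then show ?thesis unfolding p_sum by simp
  qed
  moreover have "p1 t * (9 - m t) * y1 + p2 t * (8 - m t) * y2 + p3 t * (7 - m t) * y3
    + p4 t * (6 - m t) * y4 = G / 100"
  proof -
    have "p1 t * (9 - m t) * y1 + p2 t * (8 - m t) * y2 + p3 t * (7 - m t) * y3
      + p4 t * (6 - m t) * y4 =
      (gv t * (p3 t * (7 - m t) - 2 * p1 t * (9 - m t))
        + gu t * (2 * p4 t * (6 - m t) - p2 t * (8 - m t))) / 100"
      unfolding y by (simp add: field_simps)
    also have "\<dots> = G / 100"
      unfolding G_def gu[symmetric] gv[symmetric] by (simp add: power2_eq_square)
    finally show ?thesis .
  qed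
  moreover have "p1 t * (3 * G / 2500) + p2 t * (3 * G / 2500) + p3 t * (3 * G / 2500)
    + p4 t * (3 * G / 2500) = 3 * G / 2500"
    unfolding distrib_right[symmetric] p_sum by simp
  moreover have "G \<ge> 0" unfolding G_def by simp
  \<comment> \<open>The constants leave room: 1/100 - 3/2500 exceeds 1/200.\<close>
  ultimately have N_ge: "N \<ge> G / 200" by linarith
  have e: "exp (- 2 * v (Suc t)) = exp (- 2 * v t) * exp y1"
    "exp (- u (Suc t)) = exp (- u t) * exp y2"
    "exp (v (Suc t)) = exp (v t) * exp y3"
    "exp (2 * u (Suc t)) = exp (2 * u t) * exp y4"
    unfolding y u_Suc v_Suc exp_add[symmetric] by (simp_all add: algebra_simps add_divide_distrib)
  have "Z (Suc t) = Z t * W"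
    unfolding Z[of "Suc t"] e W_def p1 p2 p3 p4 using Z_pos[of t] by (simp add: field_simps)
  then have p': "p1 (Suc t) = p1 t * exp y1 / W" "p2 (Suc t) = p2 t * exp y2 / W"
    "p3 (Suc t) = p3 t * exp y3 / W" "p4 (Suc t) = p4 t * exp y4 / W"
    unfolding p1 p2 p3 p4 e by simp_all
  have "m (Suc t) * W = 9 * (p1 t * exp y1) + 8 * (p2 t * exp y2) + 7 * (p3 t * exp y3)
    + 6 * (p4 t * exp y4)"
    unfolding m[of "Suc t"] p' using W_pos by (simp add: field_simps)
  then have "(m (Suc t) - m t) * W = N"
    unfolding N_def left_diff_distrib[of "m (Suc t)"] by (simp add: W_def algebra_simps)
  then have "m (Suc t) - m t = N / W" using W_pos by (simp add: field_simps)
  also have "\<dots> \<ge> G / 200 / 3"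
    using N_ge W_le W_pos \<open>G \<ge> 0\<close> by (intro frac_le) auto
  finally show ?thesis unfolding G_def by simp
qed

lemma m_strict_mono: "strict_mono m"
  unfolding strict_mono_Suc_iff
proof
  fix t
  have "gu t \<noteq> 0 \<or> gv t \<noteq> 0" using gu_neg[of t] gv_neg[of t] by linarith
  then have "(gu t)\<^sup>2 + (gv t)\<^sup>2 > 0" using sum_power2_gt_zero_iff by blast
  then show "m t < m (Suc t)" using m_increase[of t] by simp
qed

lemma m_limit:
  obtains L where "m \<longlonglongrightarrow> L" "\<And>t. m t < L" "L \<le> 9"
proof -
  have inc: "incseq m" using m_strict_mono by (rule strict_mono_mono)
  obtain L where L: "m \<longlonglongrightarrow> L" "\<forall>t. m t \<le> L"
    using incseq_convergent[OF inc, of 9] m_bounds less_imp_le by metis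
  show ?thesis
  proof (rule that[OF L(1)])
    show "m t < L" for t
      using L(2)[rule_format, of "Suc t"] strict_monoD[OF m_strict_mono, of t "Suc t"] by simp
    show "L \<le> 9" using L(1) m_bounds(2) by (intro LIMSEQ_le_const2[of m]) (auto intro: less_imp_le)
  qed
qed

text \<open>The increments of the convergent sequence \<open>m\<close> tend to 0 and dominate the
  squared gradient up to the factor 600.\<close>

lemma g_tendsto_zero: "gu \<longlonglongrightarrow> 0" "gv \<longlonglongrightarrow> 0"
proof -
  obtain L where L: "m \<longlonglongrightarrow> L" using m_limit by blast
  have "(\<lambda>t. 600 * (m (Suc t) - m t)) \<longlonglongrightarrow> 600 * (L - L)"
    by (intro tendsto_intros L LIMSEQ_Suc)
  then have lim: "(\<lambda>t. 600 * (m (Suc t) - m t)) \<longlonglongrightarrow> 0" by simp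
  have g_zero: "g \<longlonglongrightarrow> 0" if "\<And>t. (g t)\<^sup>2 \<le> (gu t)\<^sup>2 + (gv t)\<^sup>2" for g :: "nat \<Rightarrow> real"
  proof -
    have "(g t)\<^sup>2 \<le> 600 * (m (Suc t) - m t)" for t
      using that[of t] m_increase[of t] by (simp add: field_simps)
    then have "(\<lambda>t. (g t)\<^sup>2) \<longlonglongrightarrow> 0"
      by (intro tendsto_zero_of_mult_le[OF _ _ lim, of _ 1]) auto
    then show ?thesis by simp
  qed
  show "gu \<longlonglongrightarrow> 0" "gv \<longlonglongrightarrow> 0" by (rule g_zero, simp)+
qed

section \<open>Excluding convergence to action 3\<close>

lemma m_reaches_7: "\<exists>t. m t \<ge> 7"
proof (rule ccontr)
  assume "\<not> ?thesis"
  then have m7: "m t < 7" for t by (simp add: not_le)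
  have "(\<lambda>t. - gu t) \<longlonglongrightarrow> - 0" by (intro tendsto_intros g_tendsto_zero)
  then have lim: "(\<lambda>t. - gu t) \<longlonglongrightarrow> 0" by simp
  \<comment> \<open>While \<open>m < 7\<close>, both summands of \<open>- gu t\<close> are positive.
    Their coefficients stay away from 0, because \<open>8 - m t\<close> exceeds 1 and
    \<open>m\<close> never falls below \<open>m 0 > 6\<close>.\<close>
  have gu_ge: "p2 t \<le> - gu t" "p4 t * (2 * (m 0 - 6)) \<le> - gu t" for t
  proof -
    have "p2 t \<le> p2 t * (8 - m t)"
      using p_pos[of t] m7[of t] by (simp add: mult_le_cancel_left1)
    moreover have "p4 t * (2 * (m 0 - 6)) \<le> p4 t * (2 * (m t - 6))"
      using p_pos[of t] strict_mono_leD[OF m_strict_mono, of 0 t]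
      by (intro mult_left_mono) auto
    moreover have "p4 t * (2 * (m 0 - 6)) \<ge> 0" "p2 t > 0"
      using p_pos[of t] m_bounds[of 0] by auto
    moreover have "- gu t = p4 t * (2 * (m t - 6)) + p2 t * (8 - m t)"
      unfolding gu by (simp add: algebra_simps)
    ultimately show "p2 t \<le> - gu t" "p4 t * (2 * (m 0 - 6)) \<le> - gu t" by linarith+
  qed
  have p2_lim: "p2 \<longlonglongrightarrow> 0"
    by (rule tendsto_zero_of_mult_le[OF _ _ lim, of _ 1])
      (use p_pos gu_ge in \<open>auto intro: less_imp_le\<close>)
  have p4_lim: "p4 \<longlonglongrightarrow> 0"
    by (rule tendsto_zero_of_mult_le[OF _ _ lim, of _ "2 * (m 0 - 6)"])
      (use p_pos gu_ge m_bounds in \<open>auto intro: less_imp_le\<close>)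
  have p_less: "2 * p1 t + p2 t < p4 t" for t
    using m_deviation(3)[of t] m7[of t] by linarith
  have p1_lim: "p1 \<longlonglongrightarrow> 0"
  proof (rule tendsto_zero_of_mult_le[OF _ _ p4_lim, of _ 2])
    show "\<forall>\<^sub>F t in sequentially. p1 t * 2 \<le> p4 t"
      using p_less p_pos by (intro always_eventually allI) (smt (verit))
  qed (use p_pos in \<open>auto intro: less_imp_le\<close>)
  have "(\<lambda>t. 1 - p1 t - p2 t - p4 t) \<longlonglongrightarrow> 1 - 0 - 0 - 0"
    by (intro tendsto_intros p1_lim p2_lim p4_lim)
  moreover have "p3 = (\<lambda>t. 1 - p1 t - p2 t - p4 t)"
    using p_sum by (auto simp: algebra_simps)
  ultimately have p3_lim: "p3 \<longlonglongrightarrow> 1" by simp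
  have "(\<lambda>t. 7 + (2 * p1 t + p2 t - p4 t)) \<longlonglongrightarrow> 7 + (2 * 0 + 0 - 0)"
    by (intro tendsto_intros p1_lim p2_lim p4_lim)
  then have "m \<longlonglongrightarrow> 7" unfolding m_deviation(3)[symmetric] by simp
  \<comment> \<open>The threshold 13/2 makes \<open>2 * (m t - 6)\<close> at least 1, so that the
    decrease of \<open>u\<close> absorbs the possible increase of \<open>v\<close>, which is at most
    \<open>p4 t / 100\<close> per step.\<close>
  then have "\<forall>\<^sub>F t in sequentially. m t > 13 / 2" by (rule order_tendstoD) simp
  then obtain T where T: "\<And>t. t \<ge> T \<Longrightarrow> m t > 13 / 2"
    by (auto simp: eventually_sequentially)
  have u_pos: "u t > 0" for t
  proof -
    have "p2 t < p4 t" using p_less[of t] p_pos[of t] by linarith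
    then have "exp (- u t) < exp (2 * u t)"
      using Z_pos[of t] unfolding p2 p4 by (simp add: divide_less_cancel)
    then show ?thesis by simp
  qed
  have uv_noninc: "u (Suc t) + v (Suc t) \<le> u t + v t" if "t \<ge> T" for t
  proof -
    have "p3 t * (7 - m t) \<le> 7 - m t"
      using p_pos[of t] p_sum[of t] m7[of t] by (intro mult_left_le_one_le) auto
    moreover have "0 < p1 t * (9 - m t)" using p_pos[of t] m_bounds[of t] by simp
    ultimately have "gv t \<le> p4 t"
      using m_deviation(3)[of t] p_pos[of t] unfolding gv mult.assoc by linarith
    moreover have "p4 t * 1 \<le> p4 t * (2 * (m t - 6))"
      using T[OF that] p_pos[of t] by (intro mult_left_mono) auto
    then have "gu t \<le> - p4 t"
      using mult_pos_pos[OF p_pos(2)[of t], of "8 - m t"] m7[of t]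
      unfolding gu by (simp add: algebra_simps)
    ultimately show ?thesis unfolding u_Suc v_Suc by simp
  qed
  \<comment> \<open>Positivity of \<open>u\<close> turns the bound on \<open>u + v\<close> into one
    on \<open>v\<close> alone.\<close>
  have v_less: "v t \<le> u T + v T" if "t \<ge> T" for t
    using le_of_Suc_le[of T "\<lambda>t. - (u t + v t)" t] uv_noninc that u_pos[of t] by fastforce
  \<comment> \<open>The ratio of \<open>p1\<close> to \<open>p3\<close> is
    \<open>exp (- 3 * v t)\<close>, so a bounded \<open>v\<close> keeps \<open>p1\<close> away from
    0 as \<open>p3\<close> tends to 1.\<close>
  have "p3 t * exp (- 3 * (u T + v T)) \<le> p1 t" if "t \<ge> T" for t
  proof -
    have "p1 t = p3 t * exp (- 3 * v t)"
      unfolding p1 p3 by (simp add: exp_add[symmetric])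
    then show ?thesis using v_less[OF that] p_pos[of t] by simp
  qed
  then have "1 * exp (- 3 * (u T + v T)) \<le> 0"
    by (intro LIMSEQ_le[OF tendsto_mult_right[OF p3_lim] p1_lim]) auto
  then show False by (simp add: not_le[symmetric])
qed

section \<open>Excluding convergence to action 2\<close>

lemma m_limit_9: "m \<longlonglongrightarrow> 9"
proof -
  obtain L where L: "m \<longlonglongrightarrow> L" "\<And>t. m t < L" "L \<le> 9" using m_limit by blast
  have "\<not> L < 9"
  proof
    assume "L < 9"
    obtain T0 where T0: "m T0 \<ge> 7" using m_reaches_7 by blast
    \<comment> \<open>One further step makes the inequality strict, so \<open>m T - 7\<close> is a
      positive constant coefficient.\<close>
    define T where "T = Suc T0"
    have "m T > 7" using T0 strict_monoD[OF m_strict_mono, of T0 T] by (simp add: T_def)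
    have m_ge: "m t \<ge> m T" if "t \<ge> T" for t
      using strict_mono_leD[OF m_strict_mono that] .
    have m_gt: "m t > 7" if "t \<ge> T" for t using m_ge[OF that] \<open>m T > 7\<close> by linarith
    have "(\<lambda>t. - gu t) \<longlonglongrightarrow> - 0" "(\<lambda>t. - gv t) \<longlonglongrightarrow> - 0"
      by (intro tendsto_intros g_tendsto_zero)+
    then have lim: "(\<lambda>t. - gu t) \<longlonglongrightarrow> 0" "(\<lambda>t. - gv t) \<longlonglongrightarrow> 0" by simp_all
    have gv_ge: "p1 t * (2 * (9 - L)) \<le> - gv t" "p3 t * (m T - 7) \<le> - gv t" if "t \<ge> T" for t
    proof -
      have "- gv t = p1 t * (2 * (9 - m t)) + p3 t * (m t - 7)"
        unfolding gv by (simp add: algebra_simps)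
      moreover have "p1 t * (2 * (9 - L)) \<le> p1 t * (2 * (9 - m t))"
        using p_pos[of t] L(2)[of t] by (intro mult_left_mono) auto
      moreover have "p3 t * (m T - 7) \<le> p3 t * (m t - 7)"
        using p_pos[of t] m_ge[OF that] by (intro mult_left_mono) auto
      moreover have "p1 t * (2 * (9 - L)) \<ge> 0" "p3 t * (m T - 7) \<ge> 0"
        using p_pos[of t] \<open>L < 9\<close> \<open>m T > 7\<close> by auto
      ultimately show "p1 t * (2 * (9 - L)) \<le> - gv t" "p3 t * (m T - 7) \<le> - gv t"
        by linarith+
    qed
    have p1_lim: "p1 \<longlonglongrightarrow> 0"
      by (rule tendsto_zero_of_mult_le[OF _ _ lim(2), of _ "2 * (9 - L)"])
        (use p_pos gv_ge \<open>L < 9\<close> in \<open>auto intro: less_imp_le simp: eventually_sequentially\<close>)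
    have p3_lim: "p3 \<longlonglongrightarrow> 0"
      by (rule tendsto_zero_of_mult_le[OF _ _ lim(2), of _ "m T - 7"])
        (use p_pos gv_ge \<open>m T > 7\<close> in \<open>auto intro: less_imp_le simp: eventually_sequentially\<close>)
    \<comment> \<open>Only action 1 can push the mean above 8, and its probability vanishes.\<close>
    have "L \<le> 8 + 0"
    proof (rule LIMSEQ_le[OF L(1) tendsto_add[OF tendsto_const p1_lim]])
      have "m t \<le> 8 + p1 t" for t using m_deviation(2)[of t] p_pos[of t] by linarith
      then show "\<exists>N. \<forall>t\<ge>N. m t \<le> 8 + p1 t" by blast
    qed
    then have m8: "m t < 8" for t using L(2)[of t] by simp
    have p4_lim: "p4 \<longlonglongrightarrow> 0"
    proof (rule tendsto_zero_of_mult_le[OF _ _ lim(1), of _ 2])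
      have "p4 t * 2 \<le> - gu t" if "t \<ge> T" for t
      proof -
        have "p4 t * 2 \<le> p4 t * (2 * (m t - 6))"
          using p_pos[of t] m_gt[OF that] by (intro mult_left_mono) auto
        then show ?thesis
          using mult_pos_pos[OF p_pos(2)[of t], of "8 - m t"] m8[of t]
          unfolding gu by (simp add: algebra_simps)
      qed
      then show "\<forall>\<^sub>F t in sequentially. p4 t * 2 \<le> - gu t"
        by (auto simp: eventually_sequentially)
    qed (use p_pos in \<open>auto intro: less_imp_le\<close>)
    have "(\<lambda>t. 1 - p1 t - p3 t - p4 t) \<longlonglongrightarrow> 1 - 0 - 0 - 0"
      by (intro tendsto_intros p1_lim p3_lim p4_lim)
    moreover have "p2 = (\<lambda>t. 1 - p1 t - p3 t - p4 t)"
      using p_sum by (auto simp: algebra_simps)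
    ultimately have p2_lim: "p2 \<longlonglongrightarrow> 1" by simp
    have "(\<lambda>t. 8 + (p1 t - p3 t - 2 * p4 t)) \<longlonglongrightarrow> 8 + (0 - 0 - 2 * 0)"
      by (intro tendsto_intros p1_lim p3_lim p4_lim)
    then have m_lim: "m \<longlonglongrightarrow> 8" unfolding m_deviation(2)[symmetric] by simp
    \<comment> \<open>The ratio of \<open>p4\<close> to \<open>p2\<close> is
      \<open>exp (3 * u t)\<close>; a lower bound on \<open>u\<close> would keep \<open>p4\<close>
      away from 0.\<close>
    have u_unbounded: "\<exists>t\<ge>s. u t < b" for b s
    proof (rule ccontr)
      assume "\<not> ?thesis"
      then have "b \<le> u t" if "t \<ge> s" for t using that by (meson not_le)
      moreover have "p4 t = p2 t * exp (3 * u t)" for t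
        unfolding p2 p4 by (simp add: exp_add[symmetric])
      ultimately have "p2 t * exp (3 * b) \<le> p4 t" if "t \<ge> s" for t
        using p_pos[of t] that by simp
      then have "1 * exp (3 * b) \<le> 0"
        by (intro LIMSEQ_le[OF tendsto_mult_right[OF p2_lim] p4_lim]) auto
      then show False by (simp add: not_le[symmetric])
    qed
    have v_dec: "v (Suc t) \<le> v t" if "t \<ge> T" for t
      using gv_neg[of t] m_gt[OF that] unfolding v_Suc by simp
    have u_dec: "u (Suc t) \<le> u t" for t
      using gu_neg[of t] m8[of t] unfolding u_Suc by simp
    \<comment> \<open>Once negative, \<open>v\<close> cannot rise again, which keeps
      \<open>exp (- 2 * v t) - exp (v t)\<close> at least \<open>e > 0\<close>. But
      \<open>m < 8\<close> bounds this gap by \<open>2 * exp (2 * u t)\<close>, which is below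
      \<open>e\<close> as soon as \<open>u t < ln (e / 2) / 2\<close>.\<close>
    have v_nonneg: "v s \<ge> 0" if "s \<ge> T" for s
    proof (rule ccontr)
      assume "\<not> v s \<ge> 0"
      define e where "e = exp (- 2 * v s) - exp (v s)"
      have "e > 0" using \<open>\<not> v s \<ge> 0\<close> by (simp add: e_def)
      obtain t where t: "t \<ge> s" "u t < ln (e / 2) / 2" using u_unbounded by blast
      have "v t \<le> v s"
        using le_of_Suc_le[of s "\<lambda>t. - v t" t] v_dec that t by fastforce
      then have "e \<le> exp (- 2 * v t) - exp (v t)"
        unfolding e_def by (intro diff_mono) auto
      moreover have "p1 t < p3 t + 2 * p4 t"
        using m8[of t] m_deviation(2)[of t] by linarith
      then have "exp (- 2 * v t) < exp (v t) + 2 * exp (2 * u t)"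
        using Z_pos[of t] unfolding p1 p3 p4 by (simp add: field_simps)
      moreover have "exp (2 * u t) < exp (ln (e / 2))" using t(2) by simp
      ultimately show False using \<open>e > 0\<close> by simp
    qed
    obtain S where S: "S \<ge> T" "u S < 0" using u_unbounded by blast
    have u_neg: "u t < 0" if "t \<ge> S" for t
      using le_of_Suc_le[of S "\<lambda>t. - u t" t] u_dec that S(2) by fastforce
    have "\<forall>\<^sub>F t in sequentially. m t > 15 / 2" by (rule order_tendstoD[OF m_lim]) simp
    then obtain S' where S': "\<And>t. t \<ge> S' \<Longrightarrow> m t > 15 / 2"
      by (auto simp: eventually_sequentially)
    define R where "R = max S S'"
    \<comment> \<open>The slope 14 is the quotient of the bounds
      \<open>- gu t \<le> 7 * p3 t\<close> and \<open>- gv t \<ge> p3 t / 2\<close>. The second uses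
      \<open>m t > 15 / 2\<close>; in the first, \<open>8 - m t\<close> is at most
      \<open>p3 t + 2 * p4 t\<close>, a further \<open>4 * p4 t\<close> comes from action 4, and
      \<open>p4 t \<le> p3 t\<close>.\<close>
    have nondec: "u t - 14 * v t \<le> u (Suc t) - 14 * v (Suc t)" if "t \<ge> R" for t
    proof -
      have t: "t \<ge> T" "t \<ge> S" "m t > 15 / 2" using that S(1) S' by (auto simp: R_def)
      have "exp (2 * u t) \<le> exp (v t)" using u_neg[OF t(2)] v_nonneg[OF t(1)] by simp
      then have p43: "p4 t \<le> p3 t"
        using Z_pos[of t] unfolding p3 p4 by (simp add: divide_right_mono)
      have "p2 t * (8 - m t) \<le> 8 - m t"
        using p_pos[of t] p_sum[of t] m8[of t] by (intro mult_left_le_one_le) auto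
      moreover have "p4 t * (m t - 6) \<le> p4 t * 2"
        using p_pos[of t] m8[of t] by (intro mult_left_mono) auto
      moreover have "- gu t = p2 t * (8 - m t) + 2 * (p4 t * (m t - 6))"
        unfolding gu by (simp add: algebra_simps)
      ultimately have "- gu t \<le> 7 * p3 t"
        using m_deviation(2)[of t] p43 p_pos[of t] by linarith
      moreover have "p3 t * (1 / 2) \<le> p3 t * (m t - 7)"
        using p_pos[of t] t(3) by (intro mult_left_mono) auto
      then have "- gv t \<ge> p3 t / 2"
        using mult_pos_pos[OF p_pos(1)[of t], of "9 - m t"] m_bounds[of t]
        unfolding gv by (simp add: algebra_simps)
      ultimately show ?thesis unfolding u_Suc v_Suc by (simp add: algebra_simps)
    qed
    \<comment> \<open>At this \<open>t\<close>, monotonicity of \<open>u - 14 v\<close> would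
      require \<open>v t < 0\<close>.\<close>
    obtain t where t: "t \<ge> R" "u t < u R - 14 * v R" using u_unbounded by blast
    have "v t \<ge> 0" using v_nonneg[of t] t(1) S(1) by (simp add: R_def)
    then show False using le_of_Suc_le[of R "\<lambda>t. u t - 14 * v t" t] nondec t by fastforce
  qed
  then show ?thesis using L by simp
qed

text \<open>Actions other than 1 contribute at most 0 to \<open>m t - 8\<close>, so
  \<open>p1\<close> is squeezed between \<open>m t - 8\<close> and 1.\<close>

lemma p1_limit: "p1 \<longlonglongrightarrow> 1"
proof (rule real_tendsto_sandwich)
  have "(\<lambda>t. m t - 8) \<longlonglongrightarrow> 9 - 8" by (intro tendsto_intros m_limit_9)
  then show "(\<lambda>t. m t - 8) \<longlonglongrightarrow> 1" by simp
  show "\<forall>\<^sub>F t in sequentially. m t - 8 \<le> p1 t"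
    using m_deviation(2) p_pos by (intro always_eventually allI) (smt (verit))
  show "\<forall>\<^sub>F t in sequentially. p1 t \<le> 1"
    using p_sum p_pos by (intro always_eventually allI) (smt (verit))
qed (rule tendsto_const)

end

section \<open>From the vector iteration to the scalar one\<close>

theorem proposition1:
  fixes X :: "real ^ 2 ^ 4" and r :: "real ^ 4"
  assumes "X = vector [vector [0, -2], vector [-1, 0], vector [0, 1], vector [2, 0]]"
    and "r = vector [9, 8, 7, 6]"
  shows "\<exists>\<eta>::real. \<eta> > 0 \<and>
    (\<forall>\<theta> :: nat \<Rightarrow> real ^ 2.
      (\<forall>t\<ge>1. \<theta> (t + 1) = \<theta> t + \<eta> *\<^sub>R (transpose X *v
          ((diag (policy X (\<theta> t)) - outer_prod (policy X (\<theta> t)) (policy X (\<theta> t))) *v r)))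
      \<longrightarrow> (\<lambda>t. policy X (\<theta> t) $ 1) \<longlonglongrightarrow> 1)"
proof (intro exI[of _ "1 / 100"] conjI allI impI)
  fix \<theta> :: "nat \<Rightarrow> real ^ 2"
  assume step: "\<forall>t\<ge>1. \<theta> (t + 1) = \<theta> t + (1 / 100) *\<^sub>R (transpose X *v
          ((diag (policy X (\<theta> t)) - outer_prod (policy X (\<theta> t)) (policy X (\<theta> t))) *v r))"
  \<comment> \<open>The shift by \<open>Suc\<close> matches the recursion, which is assumed only
    from index 1 on and leaves \<open>\<theta> 0\<close> arbitrary.\<close>
  define u v where "u t = \<theta> (Suc t) $ 1" and "v t = \<theta> (Suc t) $ 2" for t
  define p where "p t = policy X (\<theta> (Suc t))" for t
  define m where "m t = 9 * p t $ 1 + 8 * p t $ 2 + 7 * p t $ 3 + 6 * p t $ 4" for t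
  define gu where "gu t = 2 * p t $ 4 * (6 - m t) - p t $ 2 * (8 - m t)" for t
  define gv where "gv t = p t $ 3 * (7 - m t) - 2 * p t $ 1 * (9 - m t)" for t
  define Z where "Z t = exp (- 2 * v t) + exp (- u t) + exp (v t) + exp (2 * u t)" for t
  have row: "X $ 1 = vector [0, -2]" "X $ 2 = vector [-1, 0]"
      "X $ 3 = vector [0, 1]" "X $ 4 = vector [2, 0]"
    unfolding assms(1) vector_4 by simp_all
  have inner: "X $ 1 \<bullet> \<theta> (Suc t) = - 2 * v t" "X $ 2 \<bullet> \<theta> (Suc t) = - u t"
      "X $ 3 \<bullet> \<theta> (Suc t) = v t" "X $ 4 \<bullet> \<theta> (Suc t) = 2 * u t" for t
    unfolding row u_def v_def by (simp_all add: inner_vec_def sum_2)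
  have Z_eq: "(\<Sum>b\<in>UNIV. exp (X $ b \<bullet> \<theta> (Suc t))) = Z t" for t
    unfolding sum_4 inner Z_def ..
  \<comment> \<open>The softmax Jacobian applied to \<open>r\<close> yields probability times
    advantage, which is the form of the summands in \<open>gu\<close> and \<open>gv\<close>.\<close>
  have cov: "((diag q - outer_prod q q) *v r) $ a = q $ a * (r $ a - q \<bullet> r)" for q :: "real ^ 4" and a
  proof -
    have "((diag q - outer_prod q q) *v r) $ a
      = (\<Sum>j\<in>UNIV. (if a = j then q $ a * r $ a else 0) - q $ a * (q $ j * r $ j))"
      unfolding matrix_vector_mult_def diag_def outer_prod_def
      by (auto simp: left_diff_distrib intro!: sum.cong)
    then show ?thesis
      by (simp add: sum_subtractf sum_distrib_left[symmetric] inner_vec_def right_diff_distrib)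
  qed
  have r: "r $ 1 = 9" "r $ 2 = 8" "r $ 3 = 7" "r $ 4 = 6"
    unfolding assms(2) vector_4 by simp_all
  have pr: "p t \<bullet> r = m t" for t
    unfolding inner_vec_def sum_4 r m_def by simp
  have transpose_component: "(transpose X *v w) $ i = (\<Sum>a\<in>UNIV. X $ a $ i * w $ a)" for w i
    unfolding matrix_vector_mult_def transpose_def by simp
  have grad: "(transpose X *v ((diag (p t) - outer_prod (p t) (p t)) *v r)) $ 1 = gu t"
      "(transpose X *v ((diag (p t) - outer_prod (p t) (p t)) *v r)) $ 2 = gv t" for t
    unfolding transpose_component sum_4 cov pr r gu_def gv_def
    by (simp_all add: row algebra_simps)
  have Suc: "\<theta> (Suc (Suc t)) = \<theta> (Suc t)
      + (1 / 100) *\<^sub>R (transpose X *v ((diag (p t) - outer_prod (p t) (p t)) *v r))" for t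
    using step[rule_format, of "Suc t"] unfolding p_def by simp
  interpret policy_gradient u v "\<lambda>t. p t $ 1" "\<lambda>t. p t $ 2" "\<lambda>t. p t $ 3" "\<lambda>t. p t $ 4" m gu gv Z
  proof
    show "u (Suc t) = u t + gu t / 100" "v (Suc t) = v t + gv t / 100" for t
      unfolding u_def v_def Suc[of t] by (simp_all add: grad del: transpose_matrix_vector)
    show "p t $ 1 = exp (- 2 * v t) / Z t" "p t $ 2 = exp (- u t) / Z t"
      "p t $ 3 = exp (v t) / Z t" "p t $ 4 = exp (2 * u t) / Z t" for t
      unfolding p_def policy_nth Z_eq inner by (rule refl)+
  qed (fact Z_def m_def gu_def gv_def)+
  show "(\<lambda>t. policy X (\<theta> t) $ 1) \<longlonglongrightarrow> 1"
    using p1_limit unfolding p_def by (rule LIMSEQ_imp_Suc)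
qed simp

end
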